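(* Let $a>0$, $b>0$ and $r>q>-a$ be real parameters, and let $\omega>0$ be defined by $\omega^{-2}=a(r-q)>0$. Consider the generalized Lorenz system $$\dot x=-a(x-y),\qquad \dot y=(r-z)x-qy,\qquad \dot z=xy-bz .$$ The one-to-one map $$V:\ (x,y,z,t)\ \to\ \left[\frac{\omega}{\sqrt2}\,x,\ \ \frac{\omega^2a}{\sqrt2}\,(y-x),\ \ \omega^2\left(az-\frac{x^2}{2}\right),\ \ \frac{t}{\omega}\right]$$ of phase variables and time transforms the generalized Lorenz system into the system $$\dot{x}=y,\qquad \dot{y}=-\left(x^2+z-1\right)x-\lambda y,\qquad \dot{z}=-\alpha z+\beta x^2 ,$$ (where the dot now denotes the derivative with respect to the new time), and the corresponding map of parameters, for fixed $q$, $P:(a,b,r)\to(\lambda,\alpha,\beta)$, is $$\lambda=(q+a)\,\omega,\qquad \alpha=b\,\omega,\qquad \beta=(2a-b)\,\omega .$$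
   Context: "Transforms" means: if $(x(t),y(t),z(t))$ is a solution of the first system, then the first three components of its image under $V$, regarded as functions of the new time $t/\omega$, form a solution of the second system, and conversely via $V^{-1}$. *)

theory Defs
  imports "HOL-Analysis.Analysis"
begin

text \<open>A solution of the autonomous system \<open>u' = F u\<close> on a non-degenerate interval \<open>I\<close>
  (derivatives are one-sided at end points belonging to \<open>I\<close>).\<close>

definition solves :: "('a::real_normed_vector \<Rightarrow> 'a) \<Rightarrow> real set \<Rightarrow> (real \<Rightarrow> 'a) \<Rightarrow> bool" where
  "solves F I u \<longleftrightarrow>
     is_interval I \<and> (\<exists>s\<in>I. \<exists>t\<in>I. s < t) \<and>
     (\<forall>t\<in>I. (u has_vector_derivative F (u t)) (at t within I))"

definition lorenz_field ::
  "real \<Rightarrow> real \<Rightarrow> real \<Rightarrow> real \<Rightarrow> real \<times> real \<times> real \<Rightarrow> real \<times> real \<times> real" where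
  "lorenz_field a b q r = (\<lambda>(x, y, z). (- a * (x - y), (r - z) * x - q * y, x * y - b * z))"

text \<open>The parameter triple is \<open>(l, \<alpha>, \<beta>)\<close>, where \<open>l\<close> is usually written lambda.\<close>

definition target_field ::
  "real \<times> real \<times> real \<Rightarrow> real \<times> real \<times> real \<Rightarrow> real \<times> real \<times> real" where
  "target_field = (\<lambda>(l, \<alpha>, \<beta>) (x, y, z).
     (y, - (x\<^sup>2 + z - 1) * x - l * y, - \<alpha> * z + \<beta> * x\<^sup>2))"

definition omega :: "real \<Rightarrow> real \<Rightarrow> real \<Rightarrow> real" where
  "omega q a r = (THE \<omega>. \<omega> > 0 \<and> \<omega> powi (- 2) = a * (r - q))"

lemma omega_eqI:
  assumes "\<omega> > 0" "\<omega> powi (- 2) = a * (r - q)"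
  shows "omega q a r = \<omega>"
  unfolding omega_def
proof (rule the_equality)
  fix v :: real
  assume v: "v > 0 \<and> v powi (- 2) = a * (r - q)"
  then have "v powi (- 2) = \<omega> powi (- 2)" using assms(2) by metis
  then have "inverse (v\<^sup>2) = inverse (\<omega>\<^sup>2)"
    by (simp only: power_int_minus power_int_numeral)
  then have "v\<^sup>2 = \<omega>\<^sup>2" by simp
  with v assms(1) show "v = \<omega>"
    by (simp add: power2_eq_iff_nonneg)
qed (use assms in simp)

lemma omega_properties:
  assumes "a > 0" "r > q"
  shows "omega q a r > 0" "omega q a r powi (- 2) = a * (r - q)"
proof -
  define v where "v = 1 / sqrt (a * (r - q))"
  have "v > 0" "v powi (- 2) = a * (r - q)"
    using assms by (simp_all add: v_def power_int_def power_divide)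
  then show "omega q a r > 0" "omega q a r powi (- 2) = a * (r - q)"
    using omega_eqI by simp_all
qed

definition V_map ::
  "real \<Rightarrow> real \<Rightarrow> real \<times> real \<times> real \<times> real \<Rightarrow> real \<times> real \<times> real \<times> real" where
  "V_map a \<omega> = (\<lambda>(x, y, z, t).
     (\<omega> / sqrt 2 * x, \<omega>\<^sup>2 * a / sqrt 2 * (y - x), \<omega>\<^sup>2 * (a * z - x\<^sup>2 / 2), t / \<omega>))"

definition P_map :: "real \<Rightarrow> real \<times> real \<times> real \<Rightarrow> real \<times> real \<times> real" where
  "P_map q = (\<lambda>(a, b, r).
     ((q + a) * omega q a r, b * omega q a r, (2 * a - b) * omega q a r))"

text \<open>The phase components of the image under \<open>W\<close> of the graph of \<open>u\<close>, as a function of the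
  new time \<open>s\<close>; here \<open>\<theta>\<close> expresses the old time through the new one.\<close>

definition image_curve ::
  "(real \<times> real \<times> real \<times> real \<Rightarrow> real \<times> real \<times> real \<times> real) \<Rightarrow> (real \<Rightarrow> real) \<Rightarrow>
   (real \<Rightarrow> real \<times> real \<times> real) \<Rightarrow> real \<Rightarrow> real \<times> real \<times> real" where
  "image_curve W \<theta> u = (\<lambda>s.
     case u (\<theta> s) of (x, y, z) \<Rightarrow> case W (x, y, z, \<theta> s) of (X, Y, Z, T) \<Rightarrow> (X, Y, Z))"

definition transforms ::
  "(real \<times> real \<times> real \<times> real \<Rightarrow> real \<times> real \<times> real \<times> real) \<Rightarrow> real \<Rightarrow>
   (real \<times> real \<times> real \<Rightarrow> real \<times> real \<times> real) \<Rightarrow>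
   (real \<times> real \<times> real \<Rightarrow> real \<times> real \<times> real) \<Rightarrow> bool" where
  "transforms V \<omega> F G \<longleftrightarrow>
     (\<forall>I u. solves F I u \<longrightarrow>
        solves G ((\<lambda>t. t / \<omega>) ` I) (image_curve V (\<lambda>s. \<omega> * s) u)) \<and>
     (\<forall>J w. solves G J w \<longrightarrow>
        solves F ((\<lambda>s. \<omega> * s) ` J) (image_curve (inv V) (\<lambda>t. t / \<omega>) w))"

end

theory Submission
  imports Defs
begin

text \<open>The phase part of the map and its inverse are polynomial, so by the chain rule both
  directions reduce to an algebraic identity: the derivative of the phase map carries the one
  vector field to the other, up to the factor by which time is rescaled.\<close>

lemma solves_transport:
  fixes \<Phi> :: "'a::real_normed_vector \<Rightarrow> 'b::real_normed_vector"
  assumes deriv: "\<And>p. (\<Phi> has_derivative \<Phi>' p) (at p)"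
    and conj: "\<And>p. c *\<^sub>R \<Phi>' p (F p) = G (\<Phi> p)"
    and c: "c > 0" and u: "solves F I u"
  shows "solves G ((\<lambda>t. t / c) ` I) (\<lambda>s. \<Phi> (u (c * s)))"
  unfolding solves_def
proof (intro conjI ballI)
  have "is_interval I" and ne: "\<exists>s\<in>I. \<exists>t\<in>I. s < t"
    and du: "\<And>t. t \<in> I \<Longrightarrow> (u has_vector_derivative F (u t)) (at t within I)"
    using u by (auto simp: solves_def)
  \<comment> \<open>Division is rewritten as scaling because a real interval is the same as a convex
    set, and convexity survives scaling.\<close>
  have img: "(\<lambda>t. t / c) ` I = (\<lambda>t. (1 / c) *\<^sub>R t) ` I" by simp
  show "is_interval ((\<lambda>t. t / c) ` I)"
    unfolding img is_interval_convex_1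
    using \<open>is_interval I\<close> by (intro convex_scaling) (simp add: is_interval_convex_1)
  show "\<exists>s\<in>(\<lambda>t. t / c) ` I. \<exists>t\<in>(\<lambda>t. t / c) ` I. s < t"
    using ne c by (simp add: divide_less_cancel)
  fix s assume "s \<in> (\<lambda>t. t / c) ` I"
  \<comment> \<open>The chain rule differentiates \<open>u\<close> within the image of the new time
    set under multiplication by \<open>c\<close>; that image is \<open>I\<close> again.\<close>
  then have s: "c * s \<in> I" and img': "(\<lambda>s. c * s) ` (\<lambda>t. t / c) ` I = I"
    using c by (auto simp: image_image)
  have "((\<lambda>s. c * s) has_vector_derivative c) (at s within (\<lambda>t. t / c) ` I)"
    by (auto intro!: derivative_eq_intros simp: has_vector_derivative_def mult.commute)
  from vector_diff_chain_within[OF this, of u] du[OF s]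
  have "((\<lambda>s. u (c * s)) has_vector_derivative c *\<^sub>R F (u (c * s)))
      (at s within (\<lambda>t. t / c) ` I)"
    by (simp add: img' o_def)
  from vector_derivative_diff_chain_within[OF this has_derivative_at_withinI[OF deriv]]
  have "((\<lambda>s. \<Phi> (u (c * s))) has_vector_derivative \<Phi>' (u (c * s)) (c *\<^sub>R F (u (c * s))))
      (at s within (\<lambda>t. t / c) ` I)"
    by (simp add: o_def)
  also have "\<Phi>' (u (c * s)) (c *\<^sub>R F (u (c * s))) = G (\<Phi> (u (c * s)))"
    by (simp add: conj linear_scale[OF has_derivative_linear[OF deriv]])
  finally show "((\<lambda>s. \<Phi> (u (c * s))) has_vector_derivative G (\<Phi> (u (c * s))))
      (at s within (\<lambda>t. t / c) ` I)" .
qed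

definition phase_map :: "real \<Rightarrow> real \<Rightarrow> real \<times> real \<times> real \<Rightarrow> real \<times> real \<times> real" where
  "phase_map a \<omega> = (\<lambda>(x, y, z).
     (\<omega> / sqrt 2 * x, \<omega>\<^sup>2 * a / sqrt 2 * (y - x), \<omega>\<^sup>2 * (a * z - x\<^sup>2 / 2)))"

text \<open>Found by solving triangularly: first for x, then for y from y - x, then for z, where x^2
  / 2 equals the square of the new first coordinate divided by
  \<open>\<omega>\<^sup>2\<close>.\<close>

definition phase_inv :: "real \<Rightarrow> real \<Rightarrow> real \<times> real \<times> real \<Rightarrow> real \<times> real \<times> real" where
  "phase_inv a \<omega> = (\<lambda>(x, y, z).
     (sqrt 2 / \<omega> * x, sqrt 2 / \<omega> * x + sqrt 2 / (\<omega>\<^sup>2 * a) * y, (z + x\<^sup>2) / (\<omega>\<^sup>2 * a)))"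

definition phase_map_deriv ::
  "real \<Rightarrow> real \<Rightarrow> real \<times> real \<times> real \<Rightarrow> real \<times> real \<times> real \<Rightarrow> real \<times> real \<times> real" where
  "phase_map_deriv a \<omega> = (\<lambda>(x, y, z) (h, k, l).
     (\<omega> / sqrt 2 * h, \<omega>\<^sup>2 * a / sqrt 2 * (k - h), \<omega>\<^sup>2 * (a * l - x * h)))"

definition phase_inv_deriv ::
  "real \<Rightarrow> real \<Rightarrow> real \<times> real \<times> real \<Rightarrow> real \<times> real \<times> real \<Rightarrow> real \<times> real \<times> real" where
  "phase_inv_deriv a \<omega> = (\<lambda>(x, y, z) (h, k, l).
     (sqrt 2 / \<omega> * h, sqrt 2 / \<omega> * h + sqrt 2 / (\<omega>\<^sup>2 * a) * k, (l + 2 * x * h) / (\<omega>\<^sup>2 * a)))"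

lemma phase_map_inv:
  assumes "a \<noteq> 0" "\<omega> \<noteq> 0"
  shows "phase_map a \<omega> (phase_inv a \<omega> p) = p"
  using assms
  by (simp add: phase_map_def phase_inv_def split_beta power_mult_distrib power_divide
      add_divide_distrib distrib_left)

lemma phase_inv_map:
  assumes "a \<noteq> 0" "\<omega> \<noteq> 0"
  shows "phase_inv a \<omega> (phase_map a \<omega> p) = p"
  using assms
  by (simp add: phase_map_def phase_inv_def split_beta power_mult_distrib power_divide
      right_diff_distrib diff_divide_distrib)

text \<open>The phase map and its inverse share this shape, linear except for one multiple of
  \<open>x\<^sup>2\<close> in the last component, so one differentiation serves both.\<close>

lemma has_derivative_quadratic_map:
  fixes A A' B C D :: real
  shows "((\<lambda>(x, y, z). (A * x, A' * x + B * y, C * z + D * x\<^sup>2)) has_derivative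
     (\<lambda>(h, k, l). case p of (x, y, z) \<Rightarrow> (A * h, A' * h + B * k, C * l + 2 * D * x * h))) (at p)"
  unfolding split_beta
  by (rule derivative_eq_intros refl)+ (simp add: fun_eq_iff)

lemma has_derivative_phase_map:
  "(phase_map a \<omega> has_derivative phase_map_deriv a \<omega> p) (at p)"
  using has_derivative_quadratic_map[of "\<omega> / sqrt 2" "- (\<omega>\<^sup>2 * a / sqrt 2)"
      "\<omega>\<^sup>2 * a / sqrt 2" "\<omega>\<^sup>2 * a" "- (\<omega>\<^sup>2 / 2)" p]
  by (simp add: phase_map_def phase_map_deriv_def split_beta algebra_simps diff_divide_distrib)

lemma has_derivative_phase_inv:
  "(phase_inv a \<omega> has_derivative phase_inv_deriv a \<omega> p) (at p)"
  using has_derivative_quadratic_map[of "sqrt 2 / \<omega>" "sqrt 2 / \<omega>" "sqrt 2 / (\<omega>\<^sup>2 * a)"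
      "1 / (\<omega>\<^sup>2 * a)" "1 / (\<omega>\<^sup>2 * a)" p]
  by (simp add: phase_inv_def phase_inv_deriv_def split_beta add_divide_distrib)

text \<open>This is the chain rule for \<open>phase_inv\<close> after \<open>phase_map\<close> being
  the identity, checked here by computation. The factor \<open>c\<close> leaves room for the time
  rescaling.\<close>

lemma phase_inv_deriv_phase_map_deriv:
  assumes "a \<noteq> 0" "\<omega> \<noteq> 0"
  shows "phase_inv_deriv a \<omega> (phase_map a \<omega> p) (c *\<^sub>R phase_map_deriv a \<omega> p v) = c *\<^sub>R v"
proof -
  have [simp]: "sqrt 2 * (sqrt 2 * t) = 2 * t" for t :: real
    by (simp flip: mult.assoc)
  show ?thesis
    using assms
    by (simp add: phase_map_def phase_inv_deriv_def phase_map_deriv_def split_beta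
        prod_eq_iff field_simps power2_eq_square)
qed

text \<open>Write X, Y, Z for the new coordinates. Since X^2 =
  \<open>\<omega>\<^sup>2 * x\<^sup>2 / 2\<close>, the square in Z cancels in X^2 + Z =
  \<open>\<omega>\<^sup>2 * a * z\<close>, which produces the cubic term. Writing (r - z) x - q y +
  a (x - y) as (r - q) x - z x - (q + a) (y - x) yields the damping term, and \<open>rel\<close>
  turns the (r - q) x part into X. In the third component the x y terms cancel.\<close>

lemma phase_map_conjugates:
  assumes rel: "\<omega>\<^sup>2 * a * (r - q) = 1"
  shows "\<omega> *\<^sub>R phase_map_deriv a \<omega> p (lorenz_field a b q r p)
     = target_field ((q + a) * \<omega>, b * \<omega>, (2 * a - b) * \<omega>) (phase_map a \<omega> p)"
proof (cases p)
  case (fields x y z)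
  \<comment> \<open>Naming 1 / sqrt 2 makes the identities polynomial, with the square of \<sigma>
    being 1/2 as a side relation for \<open>algebra\<close>.\<close>
  define \<sigma> where "\<sigma> = 1 / sqrt 2"
  have \<sigma>: "\<And>c. c / sqrt 2 = c * \<sigma>" "\<sigma> * \<sigma> = 1 / 2"
    by (simp_all add: \<sigma>_def)
  have "\<omega> * (\<omega>\<^sup>2 * a * \<sigma> * ((r - z) * x - q * y - (- a * (x - y)))) =
     - ((\<omega> * \<sigma> * x)\<^sup>2 + \<omega>\<^sup>2 * (a * z - x\<^sup>2 / 2) - 1) * (\<omega> * \<sigma> * x)
     - (q + a) * \<omega> * (\<omega>\<^sup>2 * a * \<sigma> * (y - x))"
    using rel \<sigma>(2) by algebra
  moreover have "\<omega> * (\<omega>\<^sup>2 * (a * (x * y - b * z) - x * (- a * (x - y)))) =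
     - (b * \<omega>) * (\<omega>\<^sup>2 * (a * z - x\<^sup>2 / 2)) + (2 * a - b) * \<omega> * (\<omega> * \<sigma> * x)\<^sup>2"
    using \<sigma>(2) by algebra
  moreover have "\<omega> * (\<omega> * \<sigma> * (- a * (x - y))) = \<omega>\<^sup>2 * a * \<sigma> * (y - x)"
    by algebra
  ultimately show ?thesis
    unfolding fields phase_map_def phase_map_deriv_def lorenz_field_def target_field_def prod.case scaleR_Pair
      real_scaleR_def prod.inject \<sigma>(1) by blast
qed

text \<open>No second computation is needed: the forward identity is taken at
  \<open>phase_inv a \<omega> p\<close>, and the inverse derivative is applied to both sides. Taking
  \<open>c\<close> as \<omega> there makes the argument exactly the target field at
  \<open>p\<close>.\<close>

lemma phase_inv_conjugates:
  assumes nz: "a \<noteq> 0" "\<omega> \<noteq> 0" and rel: "\<omega>\<^sup>2 * a * (r - q) = 1"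
  shows "(1 / \<omega>) *\<^sub>R phase_inv_deriv a \<omega> p
       (target_field ((q + a) * \<omega>, b * \<omega>, (2 * a - b) * \<omega>) p)
     = lorenz_field a b q r (phase_inv a \<omega> p)"
  using phase_inv_deriv_phase_map_deriv[OF nz, of "phase_inv a \<omega> p" \<omega>
      "lorenz_field a b q r (phase_inv a \<omega> p)"] nz
  by (simp add: phase_map_conjugates[OF rel] phase_map_inv[OF nz])

text \<open>The explicit inverse, time included, replaces the abstract
  \<open>inv (V_map a \<omega>)\<close> in the second half of \<open>transforms\<close>.\<close>

definition V_inv ::
  "real \<Rightarrow> real \<Rightarrow> real \<times> real \<times> real \<times> real \<Rightarrow> real \<times> real \<times> real \<times> real" where
  "V_inv a \<omega> = (\<lambda>(x, y, z, t). case phase_inv a \<omega> (x, y, z) of (X, Y, Z) \<Rightarrow> (X, Y, Z, \<omega> * t))"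

lemma V_map_phase:
  "V_map a \<omega> (x, y, z, t) = (case phase_map a \<omega> (x, y, z) of (X, Y, Z) \<Rightarrow> (X, Y, Z, t / \<omega>))"
  by (simp add: V_map_def phase_map_def)

lemma
  assumes "a \<noteq> 0" "\<omega> \<noteq> 0"
  shows V_map_comp_V_inv: "V_map a \<omega> \<circ> V_inv a \<omega> = id"
    and V_inv_comp_V_map: "V_inv a \<omega> \<circ> V_map a \<omega> = id"
  using phase_map_inv[OF assms] phase_inv_map[OF assms] assms
  by (simp_all add: fun_eq_iff V_map_phase V_inv_def split_beta)

lemma image_curve_V_map: "image_curve (V_map a \<omega>) \<theta> u = (\<lambda>s. phase_map a \<omega> (u (\<theta> s)))"
  by (auto simp: image_curve_def V_map_phase fun_eq_iff split: prod.splits)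

lemma image_curve_V_inv: "image_curve (V_inv a \<omega>) \<theta> u = (\<lambda>s. phase_inv a \<omega> (u (\<theta> s)))"
  by (auto simp: image_curve_def V_inv_def fun_eq_iff split: prod.splits)

theorem proposition1:
  fixes a b q r \<omega> :: real
  assumes "a > 0" and "b > 0" and "r > q" and "q > - a"
    and "\<omega> > 0" and "\<omega> powi (- 2) = a * (r - q)"
  shows "bij (V_map a \<omega>) \<and>
    transforms (V_map a \<omega>) \<omega> (lorenz_field a b q r) (target_field (P_map q (a, b, r)))"
proof
  have nz: "a \<noteq> 0" "\<omega> \<noteq> 0" using assms by auto
  note comp = V_map_comp_V_inv[OF nz] V_inv_comp_V_map[OF nz]
  show "bij (V_map a \<omega>)" using comp by (intro o_bij)
  have inv: "inv (V_map a \<omega>) = V_inv a \<omega>" using comp by (intro inv_unique_comp)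
  have "inverse (\<omega>\<^sup>2) = a * (r - q)"
    using assms(6) by (simp only: power_int_minus power_int_numeral)
  then have rel: "\<omega>\<^sup>2 * a * (r - q) = 1"
    using nz by (metis mult.assoc right_inverse power_not_zero)
  \<comment> \<open>The \<open>omega\<close> inside \<open>P_map\<close> is the given \<omega>, by
    uniqueness of the positive solution.\<close>
  have P: "P_map q (a, b, r) = ((q + a) * \<omega>, b * \<omega>, (2 * a - b) * \<omega>)"
    by (simp add: P_map_def omega_eqI[OF assms(5,6)])
  show "transforms (V_map a \<omega>) \<omega> (lorenz_field a b q r) (target_field (P_map q (a, b, r)))"
    unfolding transforms_def inv image_curve_V_map image_curve_V_inv P
  proof (intro conjI allI impI)
    fix I u assume "solves (lorenz_field a b q r) I u"
    then show "solves (target_field ((q + a) * \<omega>, b * \<omega>, (2 * a - b) * \<omega>))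
        ((\<lambda>t. t / \<omega>) ` I) (\<lambda>s. phase_map a \<omega> (u (\<omega> * s)))"
      by (rule solves_transport[where F = "lorenz_field a b q r",
            OF has_derivative_phase_map phase_map_conjugates[OF rel] assms(5)])
  next
    fix J w assume "solves (target_field ((q + a) * \<omega>, b * \<omega>, (2 * a - b) * \<omega>)) J w"
    \<comment> \<open>Backwards the time factor is \<open>c = 1 / \<omega>\<close>, so dividing time
      by \<open>c\<close> multiplies it by \<omega>; the closing simplification performs this
      rewriting and discharges \<open>c > 0\<close>.\<close>
    from solves_transport[where G = "lorenz_field a b q r",
        OF has_derivative_phase_inv phase_inv_conjugates[OF nz rel] _ this]
    show "solves (lorenz_field a b q r) ((\<lambda>s. \<omega> * s) ` J) (\<lambda>t. phase_inv a \<omega> (w (t / \<omega>)))"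
      using assms(5) by (simp add: mult.commute)
  qed
qed

end
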